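(* Let $\Gamma$ be a totally ordered abelian group with divisible hull $\Gamma_{\mathbb{Q}}$. Let $D$ be a non-ball cut in $\Gamma_{\mathbb{Q}}$, and let $S\in\mathrm{Init}(I)$ be the initial segment such that $H_S$ is the invariance group of $D$. Then the cofinality and coinitiality $(\kappa,\lambda)$ of $D$ take the following values: (1) If $D$ has a convexity gap (type nb+G), i.e. $S$ has a maximal element, then $\kappa=\lambda=\aleph_0$. (2) If $D$ does not have a convexity gap (type nb+NG), i.e. $S$ has no maximal element, then $\kappa=\lambda=\mathrm{cofin}(S)$.
   Context: $\Gamma_{\mathbb{Q}}=\Gamma\otimes_{\mathbb{Z}}\mathbb{Q}$ with its natural ordering extending that of $\Gamma$. A cut in an ordered abelian group $G$ is a pair $D=(D^L,D^R)$ of subsets with $D^L<D^R$ and $D^L\cup D^R=G$ (improper cuts $(\emptyset,G)$, $(G,\emptyset)$ allowed). Its cofinality $\kappa(D)$ is the cofinality of $D^L$ (least cardinality of a cofinal subset), and its coinitiality $\lambda(D)$ is the coinitiality of $D^R$ (least cardinality of a coinitial subset). A cut is principal if it is of the form $(G_{\le a},G_{>a})$ or $(G_{<a},G_{\ge a})$ with $a\in G$. The invariance group of $D$ is the convex subgroup $H(D)=\{h\in G\mid D^L+h=D^L\}$, where $\emptyset+h=\emptyset$. $D$ is a ball cut if the cut $(D^L/H,D^R/H)$ in $G/H$, with $H=H(D)$, is principal; otherwise it is a non-ball cut. Let $I$ be the set of nonzero principal convex subgroups $H(a)=\{b\mid |b|\le n|a|\text{ for some }n\in\mathbb{N}\}$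 ($a\neq0$) of $\Gamma_{\mathbb{Q}}$, ordered by descending inclusion; it is naturally identified with the corresponding set for $\Gamma$. Denote by $H_i$ the subgroup corresponding to $i\in I$, so $i<j\iff H_i\supsetneq H_j$. $\mathrm{Init}(I)$ is the set of initial segments of $I$ (including $\emptyset$ and $I$). For $S\in\mathrm{Init}(I)$ put $H_S=\bigcup_{i\in I\setminus S}H_i$ (equal to $\{0\}$ if $S=I$); every convex subgroup of $\Gamma_{\mathbb{Q}}$ is $H_S$ for a unique $S$. A cut with invariance group $H_S$ has a convexity gap if and only if $S$ has a maximal element. *)

theory Defs
  imports Main
begin

unbundle cardinal_syntax

section \<open>The divisible hull of an ordered abelian group\<close>

primrec nmul :: "nat \<Rightarrow> 'a::comm_monoid_add \<Rightarrow> 'a" where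
  "nmul 0 a = 0"
| "nmul (Suc n) a = a + nmul n a"

lemma nmul_zero [simp]: "nmul n 0 = 0"
  by (induction n) auto

lemma nmul_one [simp]: "nmul 1 a = a"
  by simp

lemma nmul_add: "nmul n (a + b) = nmul n a + nmul n b"
  by (induction n) (auto simp: ac_simps)

lemma nmul_add_left: "nmul (m + n) a = nmul m a + nmul n a"
  by (induction m) (auto simp: ac_simps)

lemma nmul_nmul: "nmul m (nmul n a) = nmul (m * n) a"
  by (induction m) (auto simp: nmul_add_left)

lemma nmul_uminus: "nmul n (- a) = - nmul n (a :: 'a::ab_group_add)"
  by (induction n) auto

lemma nmul_mono: "a \<le> b \<Longrightarrow> nmul n a \<le> nmul n (b :: 'a::ordered_ab_group_add)"
  by (induction n) (auto intro: add_mono)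

lemma nmul_strict_mono: "a < b \<Longrightarrow> 0 < n \<Longrightarrow> nmul n a < nmul n (b :: 'a::ordered_ab_group_add)"
proof (induction n)
  case (Suc n)
  then show ?case by (cases "n = 0") (auto intro: add_strict_mono)
qed simp

lemma nmul_le_iff: "0 < n \<Longrightarrow> nmul n a \<le> nmul n b \<longleftrightarrow> a \<le> (b :: 'a::linordered_ab_group_add)"
  by (meson nmul_mono nmul_strict_mono not_le)

lemma nmul_eq_iff: "0 < n \<Longrightarrow> nmul n a = nmul n b \<longleftrightarrow> a = (b :: 'a::linordered_ab_group_add)"
  by (simp add: order_eq_iff nmul_le_iff)

text \<open>
  The tensor product with the rationals is realised as the localization at the positive integers:
  a pair \<open>(a, m)\<close> with \<open>m > 0\<close> stands for \<open>a \<otimes> 1/m\<close>. Since an ordered group is torsion-free, two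
  fractions \<open>a/m\<close> and \<open>b/n\<close> are equal iff \<open>n a = m b\<close>.
\<close>

definition fracrel :: "'a::linordered_ab_group_add \<times> nat \<Rightarrow> 'a \<times> nat \<Rightarrow> bool" where
  "fracrel x y \<longleftrightarrow> 0 < snd x \<and> 0 < snd y \<and> nmul (snd y) (fst x) = nmul (snd x) (fst y)"

lemma part_equivp_fracrel: "part_equivp (fracrel :: 'a::linordered_ab_group_add \<times> nat \<Rightarrow> _)"
proof (rule part_equivpI)
  show "\<exists>x. fracrel x x"
    by (rule exI[of _ "(0, 1)"]) (simp add: fracrel_def)
  show "symp fracrel"
    by (auto simp: symp_def fracrel_def)
  show "transp (fracrel :: 'a \<times> nat \<Rightarrow> _)"
  proof (rule transpI)
    fix x y z :: "'a \<times> nat"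
    assume *: "fracrel x y" "fracrel y z"
    obtain a l b m c n where [simp]: "x = (a, l)" "y = (b, m)" "z = (c, n)"
      by (cases x, cases y, cases z)
    have pos: "0 < l" "0 < m" "0 < n" and e: "nmul m a = nmul l b" "nmul n b = nmul m c"
      using * by (auto simp: fracrel_def)
    have "nmul m (nmul n a) = nmul n (nmul m a)"
      by (simp add: nmul_nmul mult.commute)
    also have "\<dots> = nmul l (nmul n b)"
      by (simp add: e(1) nmul_nmul mult.commute)
    also have "\<dots> = nmul m (nmul l c)"
      by (simp add: e(2) nmul_nmul mult.commute)
    finally show "fracrel x z"
      using pos by (simp add: fracrel_def nmul_eq_iff)
  qed
qed

quotient_type (overloaded) 'a divhull = "'a::linordered_ab_group_add \<times> nat" / partial: fracrel
  morphisms Rep_divhull Abs_divhull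
  by (rule part_equivp_fracrel)

lemma frac_le_cong:
  fixes a b c d :: "'a::linordered_ab_group_add"
  assumes pos: "0 < k" "0 < l" "0 < m" "0 < n"
    and ab: "nmul l a = nmul k b" and cd: "nmul n c = nmul m d"
    and le: "nmul m a \<le> nmul k c"
  shows "nmul n b \<le> nmul l d"
proof -
  have "nmul (k * m) (nmul n b) = nmul (n * m) (nmul k b)"
    by (simp add: nmul_nmul ac_simps)
  also have "\<dots> = nmul (n * l) (nmul m a)"
    by (simp add: ab[symmetric] nmul_nmul ac_simps)
  also have "\<dots> \<le> nmul (n * l) (nmul k c)"
    by (rule nmul_mono[OF le])
  also have "\<dots> = nmul (l * k) (nmul n c)"
    by (simp add: nmul_nmul ac_simps)
  also have "\<dots> = nmul (k * m) (nmul l d)"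
    by (simp add: cd nmul_nmul ac_simps)
  finally show ?thesis
    using pos by (simp add: nmul_le_iff)
qed

instantiation divhull :: (linordered_ab_group_add) linordered_ab_group_add
begin

lift_definition zero_divhull :: "'a divhull" is "(0, 1)"
  by (simp add: fracrel_def)

lift_definition plus_divhull :: "'a divhull \<Rightarrow> 'a divhull \<Rightarrow> 'a divhull"
  is "\<lambda>(a, m) (b, n). (nmul n a + nmul m b, m * n)"
proof (clarsimp simp: fracrel_def nmul_add nmul_nmul)
  fix a b c d :: 'a and k l m n :: nat
  assume ab: "nmul l a = nmul k b" and cd: "nmul n c = nmul m d"
  have "nmul (l * n * m) a = nmul (n * m) (nmul l a)" by (simp add: nmul_nmul ac_simps)
  also have "\<dots> = nmul (k * m * n) b" by (simp add: ab nmul_nmul ac_simps)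
  moreover have "nmul (l * n * k) c = nmul (l * k) (nmul n c)" by (simp add: nmul_nmul ac_simps)
  moreover have "\<dots> = nmul (k * m * l) d" by (simp add: cd nmul_nmul ac_simps)
  ultimately show "nmul (l * n * m) a + nmul (l * n * k) c = nmul (k * m * n) b + nmul (k * m * l) d"
    by simp
qed

lift_definition uminus_divhull :: "'a divhull \<Rightarrow> 'a divhull" is "\<lambda>(a, m). (- a, m)"
  by (auto simp: fracrel_def nmul_uminus)

definition minus_divhull :: "'a divhull \<Rightarrow> 'a divhull \<Rightarrow> 'a divhull" where
  "minus_divhull x y = x + - y"

lift_definition less_eq_divhull :: "'a divhull \<Rightarrow> 'a divhull \<Rightarrow> bool"
  is "\<lambda>(a, m) (b, n). nmul n a \<le> nmul m b"
  unfolding fracrel_def split_beta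
  by (metis frac_le_cong)

definition less_divhull :: "'a divhull \<Rightarrow> 'a divhull \<Rightarrow> bool" where
  "less_divhull x y \<longleftrightarrow> x \<le> y \<and> \<not> y \<le> x"

instance
proof
  fix x y z :: "'a divhull"
  show "x + y + z = x + (y + z)"
    by transfer (auto simp: fracrel_def nmul_add nmul_nmul ac_simps)
  show "x + y = y + x"
    by transfer (auto simp: fracrel_def nmul_add nmul_nmul ac_simps)
  show "0 + x = x"
    by transfer (auto simp: fracrel_def)
  show "- x + x = 0"
    by transfer (auto simp: fracrel_def nmul_uminus)
  show "x - y = x + - y"
    by (simp add: minus_divhull_def)
  show "(x < y) = (x \<le> y \<and> \<not> y \<le> x)"
    by (simp add: less_divhull_def)
  show "x \<le> x"
    by transfer auto
  show "x \<le> y \<or> y \<le> x"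
    by transfer auto
  show "x = y" if "x \<le> y" "y \<le> x"
    using that by transfer (auto simp: fracrel_def)
  show "x \<le> z" if xy: "x \<le> y" and yz: "y \<le> z"
    using xy yz
  proof (transfer, clarsimp simp: fracrel_def)
    fix a b c :: 'a and l m n :: nat
    assume pos: "0 < l" "0 < m" "0 < n" and le: "nmul m a \<le> nmul l b" "nmul n b \<le> nmul m c"
    have "nmul m (nmul n a) = nmul n (nmul m a)" by (simp add: nmul_nmul ac_simps)
    also have "\<dots> \<le> nmul n (nmul l b)" by (rule nmul_mono[OF le(1)])
    also have "\<dots> = nmul l (nmul n b)" by (simp add: nmul_nmul ac_simps)
    also have "\<dots> \<le> nmul l (nmul m c)" by (rule nmul_mono[OF le(2)])
    also have "\<dots> = nmul m (nmul l c)" by (simp add: nmul_nmul ac_simps)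
    finally show "nmul n a \<le> nmul l c" using pos by (simp add: nmul_le_iff)
  qed
  show "z + x \<le> z + y" if "x \<le> y"
    using that
  proof (transfer, clarsimp simp: fracrel_def)
    fix a b c :: 'a and l m n :: nat
    assume le: "nmul m a \<le> nmul l b"
    have "nmul (n * n) (nmul m a) \<le> nmul (n * n) (nmul l b)"
      by (rule nmul_mono[OF le])
    then show "nmul (n * m) (nmul l c + nmul n a) \<le> nmul (n * l) (nmul m c + nmul n b)"
      by (simp add: nmul_add nmul_nmul ac_simps)
  qed
qed

end

instantiation divhull :: (linordered_ab_group_add) ordered_ab_group_add_abs
begin

definition abs_divhull :: "'a divhull \<Rightarrow> 'a divhull" where
  "abs_divhull x = (if x < 0 then - x else x)"

instance
proof
  fix x y :: "'a divhull"
  show ge0: "0 \<le> \<bar>x\<bar>" for x :: "'a divhull"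
    by (simp add: abs_divhull_def not_less less_imp_le)
  show ge: "x \<le> \<bar>x\<bar>" for x :: "'a divhull"
    by (auto simp: abs_divhull_def intro: order_trans[of _ 0])
  show leI: "x \<le> y \<Longrightarrow> - x \<le> y \<Longrightarrow> \<bar>x\<bar> \<le> y" for x y :: "'a divhull"
    by (simp add: abs_divhull_def)
  show minus: "\<bar>- x\<bar> = \<bar>x\<bar>" for x :: "'a divhull"
    by (auto simp: abs_divhull_def not_less)
  show "\<bar>x + y\<bar> \<le> \<bar>x\<bar> + \<bar>y\<bar>"
    by (rule leI) (use ge[of x] ge[of y] ge[of "- x"] ge[of "- y"] in
        \<open>auto simp: minus intro: add_mono dest: add_mono[of "- x" _ "- y"]\<close>)
qed

end

text \<open>
  The defining properties of the divisible hull: it is divisible, contains the given group as an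
  ordered subgroup, and every element has a positive multiple in that subgroup.
\<close>

lift_definition to_divhull :: "'a::linordered_ab_group_add \<Rightarrow> 'a divhull" is "\<lambda>a. (a, 1)"
  by (simp add: fracrel_def)

lemma to_divhull_add: "to_divhull (a + b) = to_divhull a + to_divhull b"
  by transfer (simp add: fracrel_def)

lemma to_divhull_le_iff: "to_divhull a \<le> to_divhull b \<longleftrightarrow> a \<le> b"
  by transfer simp

lift_definition hull_frac :: "'a::linordered_ab_group_add \<Rightarrow> nat \<Rightarrow> 'a divhull"
  is "\<lambda>a m. if m = 0 then (0, 1) else (a, m)"
  by (simp add: fracrel_def)

lemma divhull_cases: obtains a m where "0 < m" "x = hull_frac a m"
  by (transfer, auto simp: fracrel_def)

lemma hull_frac_add: "hull_frac a m + hull_frac b m = hull_frac (a + b) m"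
  by transfer (auto simp: fracrel_def nmul_add nmul_nmul ac_simps)

lemma nmul_hull_frac: "nmul n (hull_frac a m) = hull_frac (nmul n a) m"
proof (induction n)
  case 0
  show ?case by (simp, transfer) (auto simp: fracrel_def)
qed (simp add: hull_frac_add)

lemma divhull_divisible:
  assumes "0 < n"
  shows "\<exists>y. nmul n y = (x :: 'a::linordered_ab_group_add divhull)"
proof -
  obtain a m where "0 < m" "x = hull_frac a m" by (rule divhull_cases)
  then have "nmul n (hull_frac a (n * m)) = x"
    using assms by (simp add: nmul_hull_frac, transfer) (auto simp: fracrel_def nmul_nmul ac_simps)
  then show ?thesis ..
qed

lemma divhull_multiple: "\<exists>n a. 0 < n \<and> nmul n x = to_divhull a"
proof -
  obtain a m where m: "0 < m" "x = hull_frac a m" by (rule divhull_cases)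
  then have "nmul m x = to_divhull a"
    by (simp add: nmul_hull_frac, transfer) (auto simp: fracrel_def)
  with m show ?thesis by blast
qed


section \<open>Cuts, cofinality and coinitiality\<close>

text \<open>
  The order is a parameter because cuts are considered both in a group and in a
  quotient of it, whose elements are cosets, and because coinitiality is cofinality for the
  reversed order.
\<close>

definition cut_on :: "'b set \<Rightarrow> ('b \<Rightarrow> 'b \<Rightarrow> bool) \<Rightarrow> 'b set \<times> 'b set \<Rightarrow> bool" where
  "cut_on A le D \<longleftrightarrow> fst D \<union> snd D = A \<and> (\<forall>x\<in>fst D. \<forall>y\<in>snd D. le x y \<and> x \<noteq> y)"

definition principal_cut_on :: "'b set \<Rightarrow> ('b \<Rightarrow> 'b \<Rightarrow> bool) \<Rightarrow> 'b set \<times> 'b set \<Rightarrow> bool" where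
  "principal_cut_on A le D \<longleftrightarrow> (\<exists>a\<in>A.
     D = ({x \<in> A. le x a}, {x \<in> A. le a x \<and> x \<noteq> a}) \<or>
     D = ({x \<in> A. le x a \<and> x \<noteq> a}, {x \<in> A. le a x}))"

definition cofinal_in :: "('b \<Rightarrow> 'b \<Rightarrow> bool) \<Rightarrow> 'b set \<Rightarrow> 'b set \<Rightarrow> bool" where
  "cofinal_in le A C \<longleftrightarrow> C \<subseteq> A \<and> (\<forall>x\<in>A. \<exists>y\<in>C. le x y)"

text \<open>
  Cardinals are represented by well-orders up to \<open>=o\<close>. The chosen set has least
  cardinality among the cofinal subsets, see \<open>cofinality_least\<close> below.
\<close>

definition cofinality :: "('b \<Rightarrow> 'b \<Rightarrow> bool) \<Rightarrow> 'b set \<Rightarrow> 'b rel" where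
  "cofinality le A = |SOME C. cofinal_in le A C \<and> (\<forall>C'. cofinal_in le A C' \<longrightarrow> |C| \<le>o |C'| )|"

lemma cofinality_least:
  assumes "\<And>x. x \<in> A \<Longrightarrow> le x x"
  shows "\<exists>C. cofinal_in le A C \<and> cofinality le A = |C|"
    and "cofinal_in le A C' \<Longrightarrow> cofinality le A \<le>o |C'|"
proof -
  let ?P = "\<lambda>C. cofinal_in le A C \<and> (\<forall>C'. cofinal_in le A C' \<longrightarrow> |C| \<le>o |C'| )"
  have "cofinal_in le A A"
    using assms by (auto simp: cofinal_in_def)
  then have "\<exists>r\<in>card_of ` Collect (cofinal_in le A). \<forall>r'\<in>card_of ` Collect (cofinal_in le A). r \<le>o r'"
    by (intro exists_minim_Card_order) (auto simp: card_of_Card_order)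
  then have "\<exists>C. ?P C"
    by auto
  then have "?P (SOME C. ?P C)"
    by (rule someI_ex)
  then show "\<exists>C. cofinal_in le A C \<and> cofinality le A = |C|"
    and "cofinal_in le A C' \<Longrightarrow> cofinality le A \<le>o |C'|"
    by (auto simp: cofinality_def)
qed

definition cut_cofinality :: "'g::linordered_ab_group_add set \<times> 'g set \<Rightarrow> 'g rel" where
  "cut_cofinality D = cofinality (\<le>) (fst D)"

definition cut_coinitiality :: "'g::linordered_ab_group_add set \<times> 'g set \<Rightarrow> 'g rel" where
  "cut_coinitiality D = cofinality (\<ge>) (snd D)"


section \<open>Invariance group and ball cuts\<close>

definition invariance_group :: "'g::linordered_ab_group_add set \<times> 'g set \<Rightarrow> 'g set" where
  "invariance_group D = {h. (\<lambda>x. x + h) ` fst D = fst D}"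

definition coset :: "'g::linordered_ab_group_add set \<Rightarrow> 'g \<Rightarrow> 'g set" where
  "coset H x = (\<lambda>h. x + h) ` H"

text \<open>The order induced on the quotient by a convex subgroup, as a relation between cosets.\<close>

definition coset_le :: "'g::linordered_ab_group_add set \<Rightarrow> 'g set \<Rightarrow> bool" where
  "coset_le A B \<longleftrightarrow> (\<exists>a\<in>A. \<exists>b\<in>B. a \<le> b)"

definition ball_cut :: "'g::linordered_ab_group_add set \<times> 'g set \<Rightarrow> bool" where
  "ball_cut D \<longleftrightarrow> (let H = invariance_group D in
     principal_cut_on (range (coset H)) coset_le (coset H ` fst D, coset H ` snd D))"


section \<open>Principal convex subgroups and initial segments\<close>

definition principal_convex :: "'g::{linordered_ab_group_add, ordered_ab_group_add_abs} \<Rightarrow> 'g set" where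
  "principal_convex a = {b. \<exists>n. \<bar>b\<bar> \<le> nmul n \<bar>a\<bar>}"

text \<open>
  The index set \<open>I\<close> consists of the subgroups themselves, so that \<open>H\<^sub>i = i\<close>, and
  \<open>i \<le> j\<close> is \<open>i \<supseteq> j\<close>.
\<close>

definition prin_subgroups :: "'g::{linordered_ab_group_add, ordered_ab_group_add_abs} set set" where
  "prin_subgroups = {principal_convex a | a. a \<noteq> 0}"

definition init_segments :: "'g::{linordered_ab_group_add, ordered_ab_group_add_abs} set set set" where
  "init_segments =
     {S. S \<subseteq> prin_subgroups \<and> (\<forall>j\<in>S. \<forall>i\<in>prin_subgroups. i \<supseteq> j \<longrightarrow> i \<in> S)}"

definition convex_subgroup_of :: "'g::{linordered_ab_group_add, ordered_ab_group_add_abs} set set \<Rightarrow> 'g set" where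
  "convex_subgroup_of S = (if S = prin_subgroups then {0} else \<Union>(prin_subgroups - S))"

definition has_maximal :: "('b \<Rightarrow> 'b \<Rightarrow> bool) \<Rightarrow> 'b set \<Rightarrow> bool" where
  "has_maximal le S \<longleftrightarrow> (\<exists>m\<in>S. \<forall>i\<in>S. le m i \<longrightarrow> i = m)"

text \<open>
  Every invariance group is \<open>H\<^sub>S\<close> for exactly one initial segment \<open>S\<close>.
\<close>

lemma nmul_abs_le_mono: "m \<le> n \<Longrightarrow> nmul m \<bar>a\<bar> \<le> nmul n \<bar>a :: 'g::ordered_ab_group_add_abs\<bar>"
proof (induction n)
  case (Suc n)
  show ?case
  proof (cases "m = Suc n")
    case False
    with Suc have "0 + nmul m \<bar>a\<bar> \<le> \<bar>a\<bar> + nmul n \<bar>a\<bar>"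
      by (intro add_mono) auto
    then show ?thesis by simp
  qed simp
qed simp

lemma principal_convex_self: "a \<in> principal_convex a"
  unfolding principal_convex_def by (auto intro: exI[of _ 1])

lemma principal_convex_subset:
  assumes "b \<in> principal_convex a"
  shows "principal_convex b \<subseteq> principal_convex a"
proof
  fix c assume "c \<in> principal_convex b"
  then obtain m n where "\<bar>c\<bar> \<le> nmul m \<bar>b\<bar>" "\<bar>b\<bar> \<le> nmul n \<bar>a\<bar>"
    using assms by (auto simp: principal_convex_def)
  then have "\<bar>c\<bar> \<le> nmul (m * n) \<bar>a\<bar>"
    by (metis nmul_mono nmul_nmul order_trans)
  then show "c \<in> principal_convex a"
    by (auto simp: principal_convex_def)
qed

lemma invariance_group_iff: "h \<in> invariance_group D \<longleftrightarrow> (\<forall>x. x + h \<in> fst D \<longleftrightarrow> x \<in> fst D)"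
proof
  assume "h \<in> invariance_group D"
  then have "(\<lambda>x. x + h) ` fst D = fst D"
    by (simp add: invariance_group_def)
  then show "\<forall>x. x + h \<in> fst D \<longleftrightarrow> x \<in> fst D"
    by (metis (no_types, lifting) add_right_cancel image_iff)
next
  assume *: "\<forall>x. x + h \<in> fst D \<longleftrightarrow> x \<in> fst D"
  have "y \<in> (\<lambda>x. x + h) ` fst D" if "y \<in> fst D" for y
    using that * by (intro image_eqI[of _ _ "y - h"]) (metis diff_add_cancel)+
  then show "h \<in> invariance_group D"
    using * by (auto simp: invariance_group_def)
qed

lemma invariance_group_add:
  "g \<in> invariance_group D \<Longrightarrow> h \<in> invariance_group D \<Longrightarrow> g + h \<in> invariance_group D"
  by (simp add: invariance_group_iff flip: add.assoc)

lemma invariance_group_zero: "0 \<in> invariance_group D"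
  by (simp add: invariance_group_iff)

lemma invariance_group_uminus: "h \<in> invariance_group D \<Longrightarrow> - h \<in> invariance_group D"
  unfolding invariance_group_iff by (metis add.right_neutral add.assoc left_minus)

lemma invariance_group_nmul: "h \<in> invariance_group D \<Longrightarrow> nmul n h \<in> invariance_group D"
  by (induction n) (auto intro: invariance_group_add invariance_group_zero)

lemma invariance_group_convex:
  assumes "cut_on UNIV (\<le>) D" "h \<in> invariance_group D" "0 \<le> g" "g \<le> h"
  shows "g \<in> invariance_group D"
proof -
  have down: "y \<in> fst D" if "x \<in> fst D" "y \<le> x" for x y
  proof (rule ccontr)
    assume "y \<notin> fst D"
    then have "y \<in> snd D" using assms(1) by (auto simp: cut_on_def)
    then show False using that assms(1) by (force simp: cut_on_def)
  qed
  have "x + g \<in> fst D \<longleftrightarrow> x \<in> fst D" for x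
  proof
    show "x \<in> fst D" if "x + g \<in> fst D"
      using that by (rule down) (simp add: assms)
    show "x + g \<in> fst D" if "x \<in> fst D"
    proof (rule down)
      show "x + h \<in> fst D" using that assms(2) by (simp add: invariance_group_iff)
      show "x + g \<le> x + h" using assms by simp
    qed
  qed
  then show ?thesis by (simp add: invariance_group_iff)
qed

lemma invariance_group_principal_convex:
  fixes D :: "'g::{linordered_ab_group_add, ordered_ab_group_add_abs} set \<times> 'g set"
  assumes D: "cut_on UNIV (\<le>) D" and a: "a \<in> invariance_group D"
  shows "principal_convex a \<subseteq> invariance_group D"
proof
  fix b assume "b \<in> principal_convex a"
  then obtain n where n: "\<bar>b\<bar> \<le> nmul n \<bar>a\<bar>"
    by (auto simp: principal_convex_def)
  have "\<bar>a\<bar> \<in> invariance_group D"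
    using a invariance_group_uminus[OF a] by (cases "0 \<le> a") auto
  then have "\<bar>b\<bar> \<in> invariance_group D"
    by (intro invariance_group_convex[OF D _ _ n] invariance_group_nmul) auto
  then show "b \<in> invariance_group D"
    using invariance_group_uminus[of "\<bar>b\<bar>" D] by (cases "0 \<le> b") auto
qed

lemma convex_subgroup_of_inject:
  assumes "S \<in> init_segments" "T \<in> init_segments" "convex_subgroup_of S = convex_subgroup_of T"
  shows "S \<subseteq> T"
proof
  fix i assume i: "i \<in> S"
  then obtain a where a: "i = principal_convex a" "a \<noteq> 0"
    using assms(1) by (auto simp: init_segments_def prin_subgroups_def)
  show "i \<in> T"
  proof (rule ccontr)
    assume "i \<notin> T"
    with i assms(1) have iT: "i \<in> prin_subgroups - T"
      by (auto simp: init_segments_def)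
    then have "a \<in> convex_subgroup_of T"
      using principal_convex_self[of a] a by (auto simp: convex_subgroup_of_def)
    then have "a \<in> convex_subgroup_of S"
      using assms(3) by simp
    with a obtain j where j: "j \<in> prin_subgroups - S" "a \<in> j"
      by (auto simp: convex_subgroup_of_def split: if_splits)
    then have "i \<subseteq> j"
      using a principal_convex_subset by (auto simp: prin_subgroups_def)
    then show False
      using i j assms(1) by (auto simp: init_segments_def)
  qed
qed

lemma invariance_group_ex1:
  fixes D :: "'g::{linordered_ab_group_add, ordered_ab_group_add_abs} set \<times> 'g set"
  assumes D: "cut_on UNIV (\<le>) D"
  shows "\<exists>!S. S \<in> init_segments \<and> convex_subgroup_of S = invariance_group D"
proof (rule ex_ex1I)
  define S where "S = {i \<in> prin_subgroups. \<not> i \<subseteq> invariance_group D}"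
  have "S \<in> init_segments"
    by (auto simp: S_def init_segments_def)
  moreover have "convex_subgroup_of S = invariance_group D"
  proof (intro equalityI subsetI)
    show "x \<in> invariance_group D" if "x \<in> convex_subgroup_of S" for x
      using that invariance_group_zero[of D]
      by (auto simp: convex_subgroup_of_def S_def split: if_splits)
    show "x \<in> convex_subgroup_of S" if x: "x \<in> invariance_group D" for x
    proof (cases "x = 0")
      case False
      then have "principal_convex x \<in> prin_subgroups - S"
        using invariance_group_principal_convex[OF D x] by (auto simp: S_def prin_subgroups_def)
      then show ?thesis
        using principal_convex_self[of x] by (auto simp: convex_subgroup_of_def)
    next
      case True
      show ?thesis
      proof (cases "S = prin_subgroups")
        case False
        then obtain i where "i \<in> prin_subgroups - S" by (auto simp: S_def)
        moreover from this have "0 \<in> i"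
          by (auto simp: prin_subgroups_def principal_convex_def intro: exI[of _ 0])
        ultimately show ?thesis using True by (auto simp: convex_subgroup_of_def)
      qed (simp add: True convex_subgroup_of_def)
    qed
  qed
  ultimately show "\<exists>S. S \<in> init_segments \<and> convex_subgroup_of S = invariance_group D"
    by blast
next
  fix S T
  assume "S \<in> init_segments \<and> convex_subgroup_of S = invariance_group D"
    and "T \<in> init_segments \<and> convex_subgroup_of T = invariance_group D"
  then show "S = T"
    by (metis convex_subgroup_of_inject equalityI)
qed

end

theory Submission
  imports Defs
begin

text \<open>
  Write \<open>L\<close> and \<open>R\<close> for the two halves of \<open>D\<close>, \<open>H\<close> for its invariance group, and \<open>P\<close> for the set
  of positive elements outside \<open>H\<close>, that is, of the elements that are positive in the quotient by
  \<open>H\<close>. The idea is that the cofinality of \<open>L\<close> and the coinitiality of \<open>R\<close> are both the coinitiality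
  of \<open>P\<close>, which measures how finely the two halves approach each other, and that the latter can be
  read off from \<open>S\<close>.

  Two properties of \<open>D\<close> tie \<open>L\<close> and \<open>R\<close> to \<open>P\<close>. Since an element of \<open>P\<close> does not leave \<open>L\<close> invariant,
  every \<open>g \<in> P\<close> leads from some \<open>x \<in> L\<close> to \<open>x + g \<in> R\<close> (\<open>cut_crossed\<close>). Since \<open>D\<close> is not a
  ball cut, \<open>L\<close> has no greatest and \<open>R\<close> no least element modulo \<open>H\<close>, so every element of \<open>L\<close> can be
  increased within \<open>L\<close>, and every element of \<open>R\<close> decreased within \<open>R\<close>, by a step in \<open>P\<close>
  (\<open>nonball_no_greatest\<close>, \<open>nonball_no_least\<close>). Sending \<open>g\<close> to \<open>x\<close>, and an element of \<open>L\<close> to the step by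
  which it can be increased, one gets maps from \<open>P\<close> to \<open>L\<close> and back that carry coinitial
  sets in \<open>P\<close> to cofinal sets in \<open>L\<close> and conversely (\<open>cut_cofinality_eq\<close>); \<open>R\<close> is treated in the same way.

  It remains to compare \<open>P\<close> with \<open>S\<close>. A nonzero element lies outside \<open>H = H\<^sub>S\<close> exactly
  if it generates a member of \<open>S\<close>. If \<open>S\<close> has a maximal element, generated by \<open>a > 0\<close>,
  then every element of \<open>P\<close> is at least some fraction \<open>a/n\<close>, so that these fractions form a
  countable coinitial set; there is no finite one because \<open>P\<close> has no least element. If \<open>S\<close> has no
  maximal element, comparing elements of \<open>P\<close> amounts, up to passing to a smaller element, to comparing
  the subgroups that they generate, and the coinitiality of \<open>P\<close> is the cofinality of \<open>S\<close>
  (\<open>coinitiality_outside_maximal\<close>, \<open>coinitiality_outside_no_maximal\<close>).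
\<close>


section \<open>Comparing cofinalities\<close>

text \<open>
  The hypothesis on \<open>f\<close> says that \<open>f\<close> maps cofinal subsets of \<open>B\<close> to cofinal subsets of \<open>A\<close>,
  in the form known from the Tukey order on directed sets. A pair of such maps, one in each
  direction, shows that two cofinalities agree.
\<close>

lemma cofinality_le_of_convergent_map:
  assumes refl: "\<And>x. x \<in> A \<Longrightarrow> leA x x" "\<And>y. y \<in> B \<Longrightarrow> leB y y"
    and f: "\<And>y. y \<in> B \<Longrightarrow> f y \<in> A"
    and conv: "\<And>x. x \<in> A \<Longrightarrow> \<exists>y\<in>B. \<forall>z\<in>B. leB y z \<longrightarrow> leA x (f z)"
  shows "cofinality leA A \<le>o cofinality leB B"
proof -
  obtain C where C: "cofinal_in leB B C" "cofinality leB B = |C|"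
    using cofinality_least(1)[of B leB] refl(2) by blast
  have "cofinal_in leA A (f ` C)"
    unfolding cofinal_in_def
  proof (intro conjI ballI)
    show "f ` C \<subseteq> A"
      using C(1) f by (auto simp: cofinal_in_def)
    fix x assume "x \<in> A"
    then obtain y where "y \<in> B" "\<forall>z\<in>B. leB y z \<longrightarrow> leA x (f z)"
      using conv by blast
    then show "\<exists>z\<in>f ` C. leA x z"
      using C(1) by (force simp: cofinal_in_def)
  qed
  then have "cofinality leA A \<le>o |f ` C|"
    using cofinality_least(2)[of A leA] refl(1) by blast
  also have "|f ` C| \<le>o |C|"
    by (rule card_of_image)
  finally show ?thesis
    by (simp add: C(2))
qed

lemma natLeq_le_coinitiality:
  fixes P :: "'b::linorder set"
  assumes "P \<noteq> {}" and no_least: "\<And>g. g \<in> P \<Longrightarrow> \<exists>g'\<in>P. g' < g"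
  shows "natLeq \<le>o cofinality (\<ge>) P"
proof -
  obtain C where C: "cofinal_in (\<ge>) P C" "cofinality (\<ge>) P = |C|"
    using cofinality_least(1)[of P "(\<ge>)"] by blast
  have "infinite C"
  proof
    assume fin: "finite C"
    have "C \<noteq> {}"
      using C(1) \<open>P \<noteq> {}\<close> by (auto simp: cofinal_in_def)
    then have "Min C \<in> P"
      using C(1) fin Min_in by (auto simp: cofinal_in_def)
    then obtain g where "g \<in> P" "g < Min C"
      using no_least by blast
    moreover from this obtain c where "c \<in> C" "c \<le> g"
      using C(1) by (auto simp: cofinal_in_def)
    moreover from this have "Min C \<le> c"
      using fin by simp
    ultimately show False
      by (meson leD le_less_trans)
  qed
  then show ?thesis
    unfolding C(2) using infinite_iff_natLeq_ordLeq by blast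
qed


section \<open>Positive elements modulo the invariance group\<close>

definition positive_outside :: "'g::linordered_ab_group_add set \<Rightarrow> 'g set" where
  "positive_outside H = {g. 0 < g \<and> g \<notin> H}"

lemma coset_eq_iff:
  "coset (invariance_group D) x = coset (invariance_group D) y \<longleftrightarrow> y - x \<in> invariance_group D"
proof
  assume "coset (invariance_group D) x = coset (invariance_group D) y"
  moreover have "y \<in> coset (invariance_group D) y"
    using invariance_group_zero[of D] by (auto simp: coset_def image_iff)
  ultimately obtain h where "h \<in> invariance_group D" "y = x + h"
    by (auto simp: coset_def)
  then show "y - x \<in> invariance_group D"
    by simp
next
  have sub: "coset (invariance_group D) v \<subseteq> coset (invariance_group D) u"
    if uv: "v - u \<in> invariance_group D" for u v
  proof
    fix z assume "z \<in> coset (invariance_group D) v"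
    then obtain h where h: "h \<in> invariance_group D" "z = v + h"
      by (auto simp: coset_def)
    then have "z = u + ((v - u) + h)"
      by (simp add: algebra_simps)
    then show "z \<in> coset (invariance_group D) u"
      unfolding coset_def using invariance_group_add[OF uv h(1)] by (rule image_eqI)
  qed
  assume "y - x \<in> invariance_group D"
  then show "coset (invariance_group D) x = coset (invariance_group D) y"
    using sub[of x y] sub[of y x] invariance_group_uminus[of "y - x" D] by auto
qed

lemma coset_le_iff:
  assumes D: "cut_on UNIV (\<le>) D"
  shows "coset_le (coset (invariance_group D) x) (coset (invariance_group D) y) \<longleftrightarrow>
    x - y \<notin> positive_outside (invariance_group D)"
proof
  assume "coset_le (coset (invariance_group D) x) (coset (invariance_group D) y)"
  then obtain h k where hk: "h \<in> invariance_group D" "k \<in> invariance_group D" "x + h \<le> y + k"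
    by (auto simp: coset_le_def coset_def)
  have "k + - h \<in> invariance_group D"
    using hk by (intro invariance_group_add invariance_group_uminus)
  moreover have "x - y \<le> k + - h"
    using hk(3) by (simp add: algebra_simps)
  ultimately show "x - y \<notin> positive_outside (invariance_group D)"
    using invariance_group_convex[OF D, of "k + - h" "x - y"] by (auto simp: positive_outside_def)
next
  assume "x - y \<notin> positive_outside (invariance_group D)"
  then consider "x \<le> y" | "x - y \<in> invariance_group D"
    by (auto simp: positive_outside_def not_less)
  then show "coset_le (coset (invariance_group D) x) (coset (invariance_group D) y)"
  proof cases
    case 1
    then show ?thesis
      using invariance_group_zero[of D] by (force simp: coset_le_def coset_def)
  next
    case 2
    then have "coset (invariance_group D) y = coset (invariance_group D) x"
      by (simp add: coset_eq_iff)
    then show ?thesis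
      using invariance_group_zero[of D] by (force simp: coset_le_def coset_def)
  qed
qed

lemma coset_less_iff:
  assumes D: "cut_on UNIV (\<le>) D"
  shows "coset_le (coset (invariance_group D) x) (coset (invariance_group D) y) \<and>
      coset (invariance_group D) x \<noteq> coset (invariance_group D) y \<longleftrightarrow>
    y - x \<in> positive_outside (invariance_group D)"
proof -
  have "x - y \<in> invariance_group D \<longleftrightarrow> y - x \<in> invariance_group D"
    using invariance_group_uminus[of "x - y" D] invariance_group_uminus[of "y - x" D] by auto
  moreover have "y - x \<in> invariance_group D" if "x = y"
    using that invariance_group_zero[of D] by simp
  ultimately show ?thesis
    by (cases x y rule: linorder_cases) (auto simp: coset_le_iff[OF D] coset_eq_iff positive_outside_def)
qed


section \<open>The two halves of a non-ball cut\<close>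

lemma cut_halves:
  assumes "cut_on UNIV (\<le>) (D :: 'g::linordered_ab_group_add set \<times> 'g set)"
  shows "x \<in> snd D \<longleftrightarrow> x \<notin> fst D" and "x \<in> fst D \<Longrightarrow> y \<in> snd D \<Longrightarrow> x < y"
  using assms by (force simp: cut_on_def)+

text \<open>
  Both halves are unions of cosets of the invariance group. This makes membership
  in the halves of the induced cut in the quotient visible on representatives.
\<close>

lemma coset_in_halves_iff:
  assumes D: "cut_on UNIV (\<le>) D"
  shows "coset (invariance_group D) x \<in> coset (invariance_group D) ` fst D \<longleftrightarrow> x \<in> fst D"
    and "coset (invariance_group D) x \<in> coset (invariance_group D) ` snd D \<longleftrightarrow> x \<in> snd D"
proof -
  have sat: "u \<in> fst D \<longleftrightarrow> v \<in> fst D"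
    if eq: "coset (invariance_group D) u = coset (invariance_group D) v" for u v
  proof -
    have "u + (v - u) \<in> fst D \<longleftrightarrow> u \<in> fst D"
      using eq by (simp only: coset_eq_iff invariance_group_iff)
    then show ?thesis
      by simp
  qed
  show "coset (invariance_group D) x \<in> coset (invariance_group D) ` fst D \<longleftrightarrow> x \<in> fst D"
    using sat by blast
  show "coset (invariance_group D) x \<in> coset (invariance_group D) ` snd D \<longleftrightarrow> x \<in> snd D"
    using sat cut_halves(1)[OF D] by blast
qed

text \<open>
  An element of the left half that is greatest up to the invariance group would have a coset that
  makes the cut in the quotient principal.
\<close>

lemma nonball_no_greatest:
  fixes D :: "'g::linordered_ab_group_add set \<times> 'g set"
  assumes D: "cut_on UNIV (\<le>) D" and nb: "\<not> ball_cut D" and x: "x \<in> fst D"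
  shows "\<exists>y\<in>fst D. y - x \<in> positive_outside (invariance_group D)"
proof (rule ccontr)
  let ?c = "coset (invariance_group D)"
  assume *: "\<not> ?thesis"
  have fst_iff: "z \<in> fst D \<longleftrightarrow> z - x \<notin> positive_outside (invariance_group D)" for z
  proof
    show "z - x \<notin> positive_outside (invariance_group D)" if "z \<in> fst D"
      using that * by blast
    show "z \<in> fst D" if z: "z - x \<notin> positive_outside (invariance_group D)"
    proof (rule ccontr)
      assume "z \<notin> fst D"
      then have "x < z"
        using cut_halves[OF D] x by blast
      then have "z - x \<in> invariance_group D"
        using z by (simp add: positive_outside_def)
      then have "?c x = ?c z"
        by (simp add: coset_eq_iff)
      then show False
        using coset_in_halves_iff(1)[OF D] x \<open>z \<notin> fst D\<close> by metis
    qed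
  qed
  \<comment> \<open>The coset of \<open>x\<close> is the greatest element of the left half of the cut in the quotient.\<close>
  have "?c ` fst D = {X \<in> range ?c. coset_le X (?c x)}"
    by (auto simp: coset_le_iff[OF D] coset_in_halves_iff[OF D] fst_iff)
  moreover have "?c ` snd D = {X \<in> range ?c. coset_le (?c x) X \<and> X \<noteq> ?c x}"
  proof -
    have "{X \<in> range ?c. coset_le (?c x) X \<and> X \<noteq> ?c x} = ?c ` {z. coset_le (?c x) (?c z) \<and> ?c x \<noteq> ?c z}"
      by auto
    also have "{z. coset_le (?c x) (?c z) \<and> ?c x \<noteq> ?c z} = snd D"
      unfolding coset_less_iff[OF D] using cut_halves(1)[OF D] fst_iff by auto
    finally show ?thesis ..
  qed
  ultimately have "ball_cut D"
    unfolding ball_cut_def Let_def principal_cut_on_def by blast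
  with nb show False ..
qed

lemma nonball_no_least:
  fixes D :: "'g::linordered_ab_group_add set \<times> 'g set"
  assumes D: "cut_on UNIV (\<le>) D" and nb: "\<not> ball_cut D" and x: "x \<in> snd D"
  shows "\<exists>y\<in>snd D. x - y \<in> positive_outside (invariance_group D)"
proof (rule ccontr)
  let ?c = "coset (invariance_group D)"
  assume *: "\<not> ?thesis"
  have snd_iff: "z \<in> snd D \<longleftrightarrow> x - z \<notin> positive_outside (invariance_group D)" for z
  proof
    show "x - z \<notin> positive_outside (invariance_group D)" if "z \<in> snd D"
      using that * by blast
    show "z \<in> snd D" if z: "x - z \<notin> positive_outside (invariance_group D)"
    proof (rule ccontr)
      assume "z \<notin> snd D"
      then have "z < x"
        using cut_halves[OF D] x by blast
      then have "x - z \<in> invariance_group D"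
        using z by (simp add: positive_outside_def)
      then have "?c z = ?c x"
        by (simp add: coset_eq_iff)
      then show False
        using coset_in_halves_iff(2)[OF D] x \<open>z \<notin> snd D\<close> by metis
    qed
  qed
  \<comment> \<open>The coset of \<open>x\<close> is the least element of the right half of the cut in the quotient.\<close>
  have "?c ` snd D = {X \<in> range ?c. coset_le (?c x) X}"
    by (auto simp: coset_le_iff[OF D] coset_in_halves_iff[OF D] snd_iff)
  moreover have "?c ` fst D = {X \<in> range ?c. coset_le X (?c x) \<and> X \<noteq> ?c x}"
  proof -
    have "{X \<in> range ?c. coset_le X (?c x) \<and> X \<noteq> ?c x} = ?c ` {z. coset_le (?c z) (?c x) \<and> ?c z \<noteq> ?c x}"
      by auto
    also have "{z. coset_le (?c z) (?c x) \<and> ?c z \<noteq> ?c x} = fst D"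
      unfolding coset_less_iff[OF D] using cut_halves(1)[OF D] snd_iff by auto
    finally show ?thesis ..
  qed
  ultimately have "ball_cut D"
    unfolding ball_cut_def Let_def principal_cut_on_def by blast
  with nb show False ..
qed

text \<open>
  Translation by a positive \<open>g\<close> reflects membership in the left half; if it also preserved it,
  \<open>g\<close> would belong to the invariance group.
\<close>

lemma cut_crossed:
  fixes D :: "'g::linordered_ab_group_add set \<times> 'g set"
  assumes D: "cut_on UNIV (\<le>) D" and g: "g \<in> positive_outside (invariance_group D)"
  shows "\<exists>x\<in>fst D. x + g \<in> snd D"
proof (rule ccontr)
  assume "\<not> ?thesis"
  then have "x + g \<in> fst D" if "x \<in> fst D" for x
    using that cut_halves(1)[OF D] by blast
  moreover have "x \<in> fst D" if "x + g \<in> fst D" for x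
    using that g cut_halves[OF D] by (force simp: positive_outside_def)
  ultimately have "g \<in> invariance_group D"
    unfolding invariance_group_iff by blast
  with g show False
    by (simp add: positive_outside_def)
qed

lemma nonball_positive_outside_no_least:
  fixes D :: "'g::linordered_ab_group_add set \<times> 'g set"
  assumes D: "cut_on UNIV (\<le>) D" and nb: "\<not> ball_cut D"
    and g: "g \<in> positive_outside (invariance_group D)"
  shows "\<exists>g'\<in>positive_outside (invariance_group D). g' < g"
proof -
  obtain x where x: "x \<in> fst D" "x + g \<in> snd D"
    using cut_crossed[OF D g] by blast
  obtain y where y: "y \<in> fst D" "y - x \<in> positive_outside (invariance_group D)"
    using nonball_no_greatest[OF D nb x(1)] by blast
  have "y - x < g"
    using cut_halves(2)[OF D y(1) x(2)] by (simp add: algebra_simps)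
  with y show ?thesis by blast
qed

lemma nonball_positive_outside_nonempty:
  fixes D :: "'g::linordered_ab_group_add set \<times> 'g set"
  assumes D: "cut_on UNIV (\<le>) D" and nb: "\<not> ball_cut D"
  shows "positive_outside (invariance_group D) \<noteq> {}"
proof (cases "0 \<in> fst D")
  case True
  then show ?thesis using nonball_no_greatest[OF D nb True] by blast
next
  case False
  then have "0 \<in> snd D" using cut_halves(1)[OF D] by blast
  then show ?thesis using nonball_no_least[OF D nb] by blast
qed

text \<open>
  The short steps across the cut start far out in the left half, and far out in the left half only
  short steps stay inside it.
\<close>

lemma cut_cofinality_eq:
  fixes D :: "'g::linordered_ab_group_add set \<times> 'g set"
  assumes D: "cut_on UNIV (\<le>) D" and nb: "\<not> ball_cut D"
  shows "cut_cofinality D =o cofinality (\<ge>) (positive_outside (invariance_group D))"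
proof -
  let ?P = "positive_outside (invariance_group D)"
  obtain x where x: "\<And>g. g \<in> ?P \<Longrightarrow> x g \<in> fst D \<and> x g + g \<in> snd D"
    using bchoice[of ?P "\<lambda>g x. x \<in> fst D \<and> x + g \<in> snd D"] cut_crossed[OF D] by blast
  obtain s where s: "\<And>u. u \<in> fst D \<Longrightarrow> s u \<in> fst D \<and> s u - u \<in> ?P"
    using bchoice[of "fst D" "\<lambda>u v. v \<in> fst D \<and> v - u \<in> ?P"] nonball_no_greatest[OF D nb] by blast
  have "cofinality (\<le>) (fst D) \<le>o cofinality (\<ge>) ?P"
  proof (rule cofinality_le_of_convergent_map[where f = x])
    fix u assume u: "u \<in> fst D"
    \<comment> \<open>A step \<open>g\<close> shorter than one that stays in the left half can only leave it from beyond \<open>u\<close>.\<close>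
    have "u \<le> x g" if g: "g \<in> ?P" "g \<le> s u - u" for g
    proof -
      have "s u < x g + g"
        using cut_halves(2)[OF D] s[OF u] x[OF g(1)] by blast
      moreover have "u + g \<le> s u"
        using g(2) by (simp add: algebra_simps)
      ultimately have "u + g < x g + g"
        by (rule le_less_trans[rotated])
      then show ?thesis by simp
    qed
    then show "\<exists>g0\<in>?P. \<forall>g\<in>?P. g0 \<ge> g \<longrightarrow> u \<le> x g"
      using s[OF u] by blast
  qed (use x in auto)
  moreover have "cofinality (\<ge>) ?P \<le>o cofinality (\<le>) (fst D)"
  proof (rule cofinality_le_of_convergent_map[where f = "\<lambda>u. s u - u"])
    fix g assume g: "g \<in> ?P"
    \<comment> \<open>Beyond \<open>x g\<close> there is no room for a step of length \<open>g\<close>.\<close>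
    have "s u - u \<le> g" if u: "u \<in> fst D" "x g \<le> u" for u
    proof -
      have "s u < x g + g"
        using cut_halves(2)[OF D] s[OF u(1)] x[OF g] by blast
      also have "\<dots> \<le> u + g"
        using u(2) by simp
      finally show ?thesis by (simp add: algebra_simps)
    qed
    then show "\<exists>u0\<in>fst D. \<forall>u\<in>fst D. u0 \<le> u \<longrightarrow> g \<ge> s u - u"
      using x[OF g] by blast
  qed (use s in auto)
  ultimately show ?thesis
    by (simp add: cut_cofinality_def ordIso_iff_ordLeq)
qed

lemma cut_coinitiality_eq:
  fixes D :: "'g::linordered_ab_group_add set \<times> 'g set"
  assumes D: "cut_on UNIV (\<le>) D" and nb: "\<not> ball_cut D"
  shows "cut_coinitiality D =o cofinality (\<ge>) (positive_outside (invariance_group D))"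
proof -
  let ?P = "positive_outside (invariance_group D)"
  have "\<exists>y. y \<in> snd D \<and> y - g \<in> fst D" if "g \<in> ?P" for g
    using cut_crossed[OF D that] by (metis add_diff_cancel_right')
  then obtain y where y: "\<And>g. g \<in> ?P \<Longrightarrow> y g \<in> snd D \<and> y g - g \<in> fst D"
    using bchoice[of ?P "\<lambda>g y. y \<in> snd D \<and> y - g \<in> fst D"] by blast
  obtain s where s: "\<And>v. v \<in> snd D \<Longrightarrow> s v \<in> snd D \<and> v - s v \<in> ?P"
    using bchoice[of "snd D" "\<lambda>u v. v \<in> snd D \<and> u - v \<in> ?P"] nonball_no_least[OF D nb] by blast
  have "cofinality (\<ge>) (snd D) \<le>o cofinality (\<ge>) ?P"
  proof (rule cofinality_le_of_convergent_map[where f = y])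
    fix v assume v: "v \<in> snd D"
    have "y g \<le> v" if g: "g \<in> ?P" "g \<le> v - s v" for g
    proof -
      have "y g - g < s v"
        using cut_halves(2)[OF D] s[OF v] y[OF g(1)] by blast
      also have "\<dots> \<le> v - g"
        using g(2) by (simp add: algebra_simps)
      finally show ?thesis by simp
    qed
    then show "\<exists>g0\<in>?P. \<forall>g\<in>?P. g0 \<ge> g \<longrightarrow> v \<ge> y g"
      using s[OF v] by blast
  qed (use y in auto)
  moreover have "cofinality (\<ge>) ?P \<le>o cofinality (\<ge>) (snd D)"
  proof (rule cofinality_le_of_convergent_map[where f = "\<lambda>v. v - s v"])
    fix g assume g: "g \<in> ?P"
    have "v - s v \<le> g" if v: "v \<in> snd D" "v \<le> y g" for v
    proof -
      have "v - g \<le> y g - g"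
        using v(2) by simp
      also have "\<dots> < s v"
        using cut_halves(2)[OF D] s[OF v(1)] y[OF g] by blast
      finally show ?thesis by (simp add: algebra_simps)
    qed
    then show "\<exists>v0\<in>snd D. \<forall>v\<in>snd D. v0 \<ge> v \<longrightarrow> g \<ge> v - s v"
      using y[OF g] by blast
  qed (use s in auto)
  ultimately show ?thesis
    by (simp add: cut_coinitiality_def ordIso_iff_ordLeq)
qed


section \<open>Coinitiality modulo a convex subgroup and the initial segment\<close>

text \<open>
  A subgroup in the complement of \<open>S\<close> that contains \<open>g\<close> contains all of \<open>principal_convex g\<close>, and the
  complement of an initial segment is closed under passing to smaller subgroups.
\<close>

lemma not_in_convex_subgroup_of_iff:
  assumes S: "S \<in> init_segments" and g: "g \<noteq> 0"
  shows "g \<notin> convex_subgroup_of S \<longleftrightarrow> principal_convex g \<in> S"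
proof -
  have gI: "principal_convex g \<in> prin_subgroups"
    using g by (auto simp: prin_subgroups_def)
  show ?thesis
  proof (cases "S = prin_subgroups")
    case True
    then show ?thesis using gI g by (simp add: convex_subgroup_of_def)
  next
    case False
    have "g \<in> \<Union>(prin_subgroups - S) \<longleftrightarrow> principal_convex g \<notin> S"
    proof
      assume "g \<in> \<Union>(prin_subgroups - S)"
      then obtain j where j: "j \<in> prin_subgroups" "j \<notin> S" "g \<in> j" by blast
      then have "principal_convex g \<subseteq> j"
        using principal_convex_subset by (auto simp: prin_subgroups_def)
      then show "principal_convex g \<notin> S"
        using S j by (auto simp: init_segments_def)
    next
      assume "principal_convex g \<notin> S"
      then show "g \<in> \<Union>(prin_subgroups - S)"
        using gI principal_convex_self[of g] by blast
    qed
    then show ?thesis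
      using False by (simp add: convex_subgroup_of_def)
  qed
qed

lemma positive_outside_iff:
  assumes "S \<in> init_segments"
  shows "g \<in> positive_outside (convex_subgroup_of S) \<longleftrightarrow> 0 < g \<and> principal_convex g \<in> S"
proof (cases "0 < g")
  case True
  then have "g \<noteq> 0" by simp
  from not_in_convex_subgroup_of_iff[OF assms this] True show ?thesis
    by (simp add: positive_outside_def)
qed (simp add: positive_outside_def)

lemma principal_convex_abs: "principal_convex \<bar>a\<bar> = principal_convex a"
  by (simp add: principal_convex_def)

lemma init_segment_generator:
  fixes S :: "'g::{linordered_ab_group_add, ordered_ab_group_add_abs} set set"
  assumes "S \<in> init_segments" "i \<in> S"
  obtains a where "0 < a" "principal_convex a = i"
proof -
  obtain a where "i = principal_convex a" "a \<noteq> 0"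
    using assms by (auto simp: init_segments_def prin_subgroups_def)
  then show ?thesis
    using that[of "\<bar>a\<bar>"] by (simp add: principal_convex_abs)
qed

lemma in_principal_convex_of_le:
  fixes a b :: "'g::{linordered_ab_group_add, ordered_ab_group_add_abs}"
  assumes "0 \<le> b" "b \<le> a"
  shows "b \<in> principal_convex a"
proof -
  have "\<bar>b\<bar> \<le> nmul 1 \<bar>a\<bar>"
    using assms by simp
  then show ?thesis
    unfolding principal_convex_def by blast
qed

text \<open>
  Write \<open>H(b)\<close> for \<open>principal_convex b\<close>.
  Subgroups only see elements up to multiples, so that \<open>H\<^sub>i \<subseteq> H(b)\<close> does not make the chosen
  generator of \<open>H\<^sub>i\<close> smaller than \<open>b\<close>. A strictly smaller subgroup does, and this is what the
  absence of a maximal element of \<open>S\<close> provides.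
\<close>

lemma coinitiality_outside_no_maximal:
  fixes S :: "'g::{linordered_ab_group_add, ordered_ab_group_add_abs} set set"
  assumes S: "S \<in> init_segments" and nomax: "\<not> has_maximal (\<supseteq>) S"
  shows "cofinality (\<ge>) (positive_outside (convex_subgroup_of S)) =o cofinality (\<supseteq>) S"
proof -
  let ?P = "positive_outside (convex_subgroup_of S)"
  have "\<exists>a. 0 < a \<and> principal_convex a = i" if "i \<in> S" for i
    using init_segment_generator[OF S that] by blast
  then obtain d where d: "\<And>i. i \<in> S \<Longrightarrow> 0 < d i \<and> principal_convex (d i) = i"
    using bchoice[of S "\<lambda>i a. 0 < a \<and> principal_convex a = i"] by blast
  have dP: "d i \<in> ?P" if "i \<in> S" for i
    using d[OF that] that by (simp add: positive_outside_iff[OF S])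
  have "cofinality (\<ge>) ?P \<le>o cofinality (\<supseteq>) S"
  proof (rule cofinality_le_of_convergent_map[where f = d])
    fix b assume "b \<in> ?P"
    then have b: "0 < b" "principal_convex b \<in> S"
      by (simp_all add: positive_outside_iff[OF S])
    then obtain j where j: "j \<in> S" "j \<subset> principal_convex b"
      using nomax unfolding has_maximal_def by blast
    have "d i \<le> b" if i: "i \<in> S" "i \<subseteq> j" for i
    proof (rule ccontr)
      assume "\<not> d i \<le> b"
      then have "b \<in> i"
        using in_principal_convex_of_le[of b "d i"] b(1) d[OF i(1)] by simp
      then have "principal_convex b \<subseteq> i"
        using principal_convex_subset[of b "d i"] d[OF i(1)] by simp
      with i(2) j(2) show False by blast
    qed
    then show "\<exists>j\<in>S. \<forall>i\<in>S. j \<supseteq> i \<longrightarrow> b \<ge> d i"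
      using j(1) by blast
  qed (use dP in auto)
  moreover have "cofinality (\<supseteq>) S \<le>o cofinality (\<ge>) ?P"
  proof (rule cofinality_le_of_convergent_map[where f = principal_convex])
    fix i assume i: "i \<in> S"
    have "principal_convex c \<subseteq> i" if c: "c \<in> ?P" "c \<le> d i" for c
    proof -
      have "c \<in> principal_convex (d i)"
        using c by (intro in_principal_convex_of_le) (auto simp: positive_outside_def)
      from principal_convex_subset[OF this] show ?thesis
        using d[OF i] by simp
    qed
    then show "\<exists>g\<in>?P. \<forall>c\<in>?P. g \<ge> c \<longrightarrow> i \<supseteq> principal_convex c"
      using dP[OF i] by blast
  qed (auto simp: positive_outside_iff[OF S])
  ultimately show ?thesis
    by (simp add: ordIso_iff_ordLeq)
qed

lemma nmul_pos_iff:
  "0 < n \<Longrightarrow> 0 < nmul n a \<longleftrightarrow> 0 < (a :: 'g::linordered_ab_group_add)"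
  using nmul_le_iff[of n a 0] by (metis nmul_zero not_le)

text \<open>
  Maximality of \<open>H(a)\<close> in \<open>S\<close> makes the quotient of \<open>H(a)\<close> by \<open>H\<^sub>S\<close> archimedean, so that the
  fractions of \<open>a\<close>, which exist by divisibility, get below every positive element of it.
\<close>

lemma coinitiality_outside_maximal:
  fixes S :: "'g::{linordered_ab_group_add, ordered_ab_group_add_abs} set set"
  assumes S: "S \<in> init_segments" and max: "has_maximal (\<supseteq>) S"
    and divisible: "\<And>n x. 0 < n \<Longrightarrow> \<exists>y :: 'g. nmul n y = x"
  shows "cofinality (\<ge>) (positive_outside (convex_subgroup_of S)) \<le>o natLeq"
proof -
  let ?P = "positive_outside (convex_subgroup_of S)"
  obtain m where m: "m \<in> S" "\<And>i. i \<in> S \<Longrightarrow> i \<subseteq> m \<Longrightarrow> i = m"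
    using max by (auto simp: has_maximal_def)
  obtain a where a: "0 < a" "principal_convex a = m"
    using init_segment_generator[OF S m(1)] by blast
  have "\<And>n. \<exists>y. nmul (Suc n) y = a"
    by (rule divisible) simp
  then obtain f where f: "\<And>n. nmul (Suc n) (f n) = a"
    by metis
  have f_pos: "0 < f n" for n
    using nmul_pos_iff[of "Suc n" "f n"] f[of n] a(1) by simp
  have f_gen: "principal_convex (f n) = m" for n
  proof
    have "a \<in> principal_convex (f n)"
      using f[of n] f_pos[of n] a(1)
      by (auto simp: principal_convex_def simp del: nmul.simps intro!: exI[of _ "Suc n"])
    then show "m \<subseteq> principal_convex (f n)"
      using principal_convex_subset a(2) by blast
    have "f n = nmul 1 \<bar>f n\<bar>"
      using f_pos[of n] by simp
    also have "\<dots> \<le> nmul (Suc n) \<bar>f n\<bar>"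
      by (rule nmul_abs_le_mono) simp
    also have "\<dots> = a"
      using f[of n] f_pos[of n] by (simp del: nmul.simps)
    finally have "f n \<in> principal_convex a"
      using f_pos[of n] by (intro in_principal_convex_of_le) auto
    then show "principal_convex (f n) \<subseteq> m"
      using principal_convex_subset a(2) by blast
  qed
  have "cofinality (\<ge>) ?P \<le>o cofinality (\<le>) (UNIV :: nat set)"
  proof (rule cofinality_le_of_convergent_map[where f = f])
    fix b assume "b \<in> ?P"
    then have b: "0 < b" "principal_convex b \<in> S"
      by (simp_all add: positive_outside_iff[OF S])
    have "a \<in> principal_convex b"
    proof (cases "a \<le> b")
      case True
      then show ?thesis using a(1) by (intro in_principal_convex_of_le) auto
    next
      case False
      then have "principal_convex b \<subseteq> m"
        using principal_convex_subset[of b a] in_principal_convex_of_le[of b a] a b(1) by simp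
      then have "principal_convex b = m"
        by (rule m(2)[OF b(2)])
      then show ?thesis
        using principal_convex_self[of a] a(2) by simp
    qed
    then obtain n where n: "a \<le> nmul n b"
      using a(1) b(1) by (auto simp: principal_convex_def)
    have "f k \<le> b" if "n \<le> k" for k
    proof -
      have "nmul (Suc k) (f k) \<le> nmul n b"
        using n by (simp only: f)
      also have "\<dots> \<le> nmul (Suc k) b"
        using nmul_abs_le_mono[of n "Suc k" b] that b(1) by (simp del: nmul.simps)
      finally show ?thesis
        by (simp add: nmul_le_iff del: nmul.simps)
    qed
    then show "\<exists>n\<in>UNIV. \<forall>k\<in>UNIV. n \<le> k \<longrightarrow> b \<ge> f k"
      by blast
  qed (use f_pos f_gen m(1) in \<open>auto simp: positive_outside_iff[OF S]\<close>)
  also have "cofinality (\<le>) (UNIV :: nat set) \<le>o |UNIV :: nat set|"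
    by (rule cofinality_least(2)) (auto simp: cofinal_in_def)
  also have "|UNIV :: nat set| =o natLeq"
    by (rule card_of_nat)
  finally show ?thesis .
qed


section \<open>Cofinality and coinitiality of non-ball cuts\<close>

theorem theorem4p5:
  fixes D :: "'a::linordered_ab_group_add divhull set \<times> 'a divhull set"
    and S :: "'a divhull set set"
  assumes "cut_on UNIV (\<le>) D"
    and "\<not> ball_cut D"
    and "S \<in> init_segments"
    and "convex_subgroup_of S = invariance_group D"
  shows "(has_maximal (\<supseteq>) S \<longrightarrow>
            cut_cofinality D =o natLeq \<and> cut_coinitiality D =o natLeq) \<and>
         (\<not> has_maximal (\<supseteq>) S \<longrightarrow>
            cut_cofinality D =o cofinality (\<supseteq>) S \<and> cut_coinitiality D =o cofinality (\<supseteq>) S)"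
proof -
  let ?P = "positive_outside (invariance_group D)"
  have cof: "cut_cofinality D =o cofinality (\<ge>) ?P"
    by (rule cut_cofinality_eq[OF assms(1,2)])
  have coin: "cut_coinitiality D =o cofinality (\<ge>) ?P"
    by (rule cut_coinitiality_eq[OF assms(1,2)])
  have coin_nat: "cofinality (\<ge>) ?P =o natLeq" if max: "has_maximal (\<supseteq>) S"
  proof -
    have "cofinality (\<ge>) ?P \<le>o natLeq"
      using coinitiality_outside_maximal[OF assms(3) max divhull_divisible] by (simp add: assms(4))
    moreover have "natLeq \<le>o cofinality (\<ge>) ?P"
      using nonball_positive_outside_nonempty[OF assms(1,2)]
        nonball_positive_outside_no_least[OF assms(1,2)]
      by (rule natLeq_le_coinitiality)
    ultimately show ?thesis
      by (simp add: ordIso_iff_ordLeq)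
  qed
  have coin_S: "cofinality (\<ge>) ?P =o cofinality (\<supseteq>) S" if "\<not> has_maximal (\<supseteq>) S"
    using coinitiality_outside_no_maximal[OF assms(3) that] by (simp add: assms(4))
  show ?thesis
    by (intro conjI impI ordIso_transitive[OF cof] ordIso_transitive[OF coin] coin_nat coin_S)
qed

end
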